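(* Let $d\ge1$, $m>0$, $\varkappa>0$, $0\le a\in L^1(\mathbb{R}^d)$ with $\int_{\mathbb{R}^d}a(x)\,dx=1$, let $E$ be one of the spaces $C_{ub}(\mathbb{R}^d)$, $C_b(\mathbb{R}^d)$, $L^\infty(\mathbb{R}^d)$, and let $G:E\to E$. Assume: (1) $\beta:=\varkappa-m>0$; (2) there exists $\theta>0$ such that $0=G0\le Gv\le G\theta=\beta$ for all $v\in E_\theta^+$; (3) there exists $l_\theta>0$ such that $\|Gv-Gw\|_E\le l_\theta\|v-w\|_E$ for all $v,w\in E_\theta^+$; (4) for some $p\ge0$ and all $v,w\in E_\theta^+$ with $v\le w$, one has $\varkappa\,a*v-v\,Gv+pv\le\varkappa\,a*w-w\,Gw+pw$. Consider the equation $$\frac{\partial u}{\partial t}(x,t)=\varkappa(a*u)(x,t)-m\,u(x,t)-u(x,t)(Gu)(x,t),\qquad t>0,\ x\in\mathbb{R}^d. \qquad ( * )$$ (I) Let $T>0$ be fixed and let $u_1,u_2\in C([0,T]\to E)\cap C^1((0,T]\to E)$ be such that, for all $t\in(0,T]$, $x\in\mathbb{R}^d$, $$\frac{\partial u_1}{\partial t}-\varkappa\,a*u_1+mu_1+u_1Gu_1\le\frac{\partial u_2}{\partial t}-\varkappa\,a*u_2+mu_2+u_2Gu_2,$$ $$0\le u_1(x,t)\le\theta,\qquad 0\le u_2(x,t)\le\theta,\qquad 0\le u_1(x,0)\le u_2(x,0)\le\theta .$$ Then $0\le u_1(x,t)\le u_2(x,t)\le\theta$ for all $t\in[0,T]$,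 $x\in\mathbb{R}^d$. (II) Let $u\in C([0,\infty)\to E)\cap C^1((0,\infty)\to E)$ be a classical solution to $( * )$ with $u(\cdot,0)=u_0$, $0\le u_0\le\theta$, given by the following existence and uniqueness result: if $Gv\ge0$ for all $0\le v\in E$ and, for some $\kappa>0$, $\|Gv-Gw\|_E\le e^{\kappa r}\|v-w\|_E$ for all $r>0$ and $v,w\in E_r^+$, then for every $0\le u_0\in E$ there exists a unique nonnegative classical solution to $( * )$ on $[0,\infty)$ with $u(\cdot,0)=u_0$. Then $0\le u(x,t)\le\theta$ for all $t\ge0$, $x\in\mathbb{R}^d$. (III) In particular, let $u_1,u_2\in C([0,\infty)\to E)\cap C^1((0,\infty)\to E)$ solve $( * )$ and $0\le u_1(x,0)\le u_2(x,0)\le\theta$, $x\in\mathbb{R}^d$. Then $0\le u_1(x,t)\le u_2(x,t)\le\theta$ for all $t\ge0$, $x\in\mathbb{R}^d$.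
   Context: $C_{ub}(\mathbb{R}^d)$ and $C_b(\mathbb{R}^d)$ are the spaces of bounded uniformly continuous, respectively bounded continuous, real functions with the sup-norm; $L^\infty(\mathbb{R}^d)$ has the esssup-norm. Inequalities between elements of $E$ are pointwise (a.e. if $E=L^\infty$). For $r>0$, $E_r^+:=\{v\in E:0\le v\le r\}$. Constants are identified with constant functions. $(a*u)(x,t)=\int_{\mathbb{R}^d}a(x-y)u(y,t)\,dy$; $(Gu)(x,t)$ means $(Gu(\cdot,t))(x)$. A classical solution on $[0,\infty)$ with initial condition $u_0\in E$ is a function $u\in C([0,\infty)\to E)\cap C^1((0,\infty)\to E)$ which satisfies the equation for $t>0$ and $u(\cdot,0)=u_0$ in $E$.
   Formalization: In (III), G is assumed to satisfy the hypotheses of the existence and uniqueness result in (II), and u_1, u_2 are nonnegative classical solutions; without this (III) fails, since (2)-(4) do not restrict G outside E_θ^+. *)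

theory Defs
  imports "HOL-Analysis.Analysis" "HOL-Probability.Essential_Supremum"
begin

text \<open>
  The three spaces are handled uniformly through functions on \<open>\<real>\<^sup>d = real ^ 'n\<close>.
  For \<open>L\<^sup>\<infinity>\<close> the elements are representatives, so that equality in the space is
  \<open>E_eq\<close> (equality almost everywhere); every notion below that involves \<open>E\<close> is invariant
  under changing representatives, except that a map on \<open>E\<close> has to be required to respect
  \<open>E_eq\<close> (see \<open>E_map\<close>).
\<close>

datatype fspace = C_ub | C_b | L_inf

fun E_carrier :: "fspace \<Rightarrow> (real ^ 'n \<Rightarrow> real) set" where
  "E_carrier C_ub = {f. bounded (range f) \<and> uniformly_continuous_on UNIV f}"
| "E_carrier C_b = {f. bounded (range f) \<and> continuous_on UNIV f}"
| "E_carrier L_inf =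
     {f. f \<in> borel_measurable lebesgue \<and> esssup lebesgue (\<lambda>x. ereal \<bar>f x\<bar>) < \<infinity>}"

fun E_norm :: "fspace \<Rightarrow> (real ^ 'n \<Rightarrow> real) \<Rightarrow> real" where
  "E_norm C_ub f = (SUP x. \<bar>f x\<bar>)"
| "E_norm C_b f = (SUP x. \<bar>f x\<bar>)"
| "E_norm L_inf f = real_of_ereal (esssup lebesgue (\<lambda>x. ereal \<bar>f x\<bar>))"

fun E_le :: "fspace \<Rightarrow> (real ^ 'n \<Rightarrow> real) \<Rightarrow> (real ^ 'n \<Rightarrow> real) \<Rightarrow> bool" where
  "E_le C_ub f g \<longleftrightarrow> (\<forall>x. f x \<le> g x)"
| "E_le C_b f g \<longleftrightarrow> (\<forall>x. f x \<le> g x)"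
| "E_le L_inf f g \<longleftrightarrow> (AE x in lebesgue. f x \<le> g x)"

fun E_eq :: "fspace \<Rightarrow> (real ^ 'n \<Rightarrow> real) \<Rightarrow> (real ^ 'n \<Rightarrow> real) \<Rightarrow> bool" where
  "E_eq C_ub f g \<longleftrightarrow> f = g"
| "E_eq C_b f g \<longleftrightarrow> f = g"
| "E_eq L_inf f g \<longleftrightarrow> (AE x in lebesgue. f x = g x)"

definition E_between :: "fspace \<Rightarrow> real \<Rightarrow> (real ^ 'n \<Rightarrow> real) set" where
  "E_between E r = {v \<in> E_carrier E. E_le E (\<lambda>x. 0) v \<and> E_le E v (\<lambda>x. r)}"

definition E_map :: "fspace \<Rightarrow> ((real ^ 'n \<Rightarrow> real) \<Rightarrow> (real ^ 'n \<Rightarrow> real)) \<Rightarrow> bool" where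
  "E_map E G \<longleftrightarrow> (\<forall>v\<in>E_carrier E. G v \<in> E_carrier E) \<and>
     (\<forall>v\<in>E_carrier E. \<forall>w\<in>E_carrier E. E_eq E v w \<longrightarrow> E_eq E (G v) (G w))"

definition conv :: "(real ^ 'n \<Rightarrow> real) \<Rightarrow> (real ^ 'n \<Rightarrow> real) \<Rightarrow> real ^ 'n \<Rightarrow> real" where
  "conv a v x = (LINT y|lebesgue. a (x - y) * v y)"

text \<open>
  Curves \<open>u :: real \<Rightarrow> (real ^ 'n \<Rightarrow> real)\<close> with \<open>u t = u(\<cdot>,t)\<close>.  Continuity and the time derivative
  are those of the normed space \<open>E\<close>, i.e. the limits are taken in \<open>E_norm E\<close>.  The limits are
  relative to \<open>S\<close>, hence one-sided at an endpoint of \<open>S\<close>.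
\<close>

definition E_continuous_on ::
    "fspace \<Rightarrow> real set \<Rightarrow> (real \<Rightarrow> real ^ 'n \<Rightarrow> real) \<Rightarrow> bool" where
  "E_continuous_on E S u \<longleftrightarrow> (\<forall>t\<in>S. u t \<in> E_carrier E) \<and>
     (\<forall>t\<in>S. ((\<lambda>s. E_norm E (\<lambda>x. u s x - u t x)) \<longlongrightarrow> 0) (at t within S))"

text \<open>\<open>u\<close> is in \<open>C\<^sup>1(S \<rightarrow> E)\<close> with derivative \<open>u'\<close>:\<close>

definition E_C1_on ::
    "fspace \<Rightarrow> real set \<Rightarrow> (real \<Rightarrow> real ^ 'n \<Rightarrow> real) \<Rightarrow> (real \<Rightarrow> real ^ 'n \<Rightarrow> real) \<Rightarrow> bool" where
  "E_C1_on E S u u' \<longleftrightarrow> (\<forall>t\<in>S. u t \<in> E_carrier E) \<and>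
     (\<forall>t\<in>S. ((\<lambda>s. E_norm E (\<lambda>x. (u s x - u t x) / (s - t) - u' t x)) \<longlongrightarrow> 0) (at t within S)) \<and>
     E_continuous_on E S u'"

definition classical_solution ::
    "fspace \<Rightarrow> real \<Rightarrow> real \<Rightarrow> (real ^ 'n \<Rightarrow> real) \<Rightarrow> ((real ^ 'n \<Rightarrow> real) \<Rightarrow> (real ^ 'n \<Rightarrow> real))
      \<Rightarrow> (real ^ 'n \<Rightarrow> real) \<Rightarrow> (real \<Rightarrow> real ^ 'n \<Rightarrow> real) \<Rightarrow> bool" where
  "classical_solution E \<kappa> m a G u0 u \<longleftrightarrow>
     E_continuous_on E {0..} u \<and>
     (\<exists>u'. E_C1_on E {0<..} u u' \<and>
        (\<forall>t>0. E_eq E (u' t) (\<lambda>x. \<kappa> * conv a (u t) x - m * u t x - u t x * G (u t) x))) \<and>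
     E_eq E (u 0) u0"

definition nonneg_classical_solution ::
    "fspace \<Rightarrow> real \<Rightarrow> real \<Rightarrow> (real ^ 'n \<Rightarrow> real) \<Rightarrow> ((real ^ 'n \<Rightarrow> real) \<Rightarrow> (real ^ 'n \<Rightarrow> real))
      \<Rightarrow> (real ^ 'n \<Rightarrow> real) \<Rightarrow> (real \<Rightarrow> real ^ 'n \<Rightarrow> real) \<Rightarrow> bool" where
  "nonneg_classical_solution E \<kappa> m a G u0 u \<longleftrightarrow>
     classical_solution E \<kappa> m a G u0 u \<and> (\<forall>t\<ge>0. E_le E (\<lambda>x. 0) (u t))"

text \<open>
  The hypotheses on \<open>G\<close> under which every nonnegative initial condition in \<open>E\<close> has a unique
  nonnegative classical solution on \<open>[0,\<infinity>)\<close>: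
\<close>

definition existence_hypotheses ::
    "fspace \<Rightarrow> ((real ^ 'n \<Rightarrow> real) \<Rightarrow> (real ^ 'n \<Rightarrow> real)) \<Rightarrow> bool" where
  "existence_hypotheses E G \<longleftrightarrow>
     (\<forall>v\<in>E_carrier E. E_le E (\<lambda>x. 0) v \<longrightarrow> E_le E (\<lambda>x. 0) (G v)) \<and>
     (\<exists>k>0. \<forall>r>0. \<forall>v\<in>E_between E r. \<forall>w\<in>E_between E r.
        E_norm E (\<lambda>x. G v x - G w x) \<le> exp (k * r) * E_norm E (\<lambda>x. v x - w x))"

end

theory Submission
  imports Defs
begin

text \<open>
  Both comparison statements are instances of a maximum principle for curves in \<open>E\<close>
  (\<open>nonpos_of_derivative_bound\<close>): if \<open>z 0 \<le> 0\<close> and, at every time \<open>t > 0\<close> and every point where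
  \<open>z t > 0\<close>, the derivative satisfies \<open>z' t \<le> C * \<phi> t\<close> with \<open>\<phi> t\<close> the norm of the positive part of
  \<open>z t\<close>, then \<open>z \<le> 0\<close>. Indeed, let \<open>r\<close> be a maximum point of \<open>exp (- K t) \<phi> t\<close> with \<open>K > C\<close>. If
  \<open>\<phi> r > 0\<close>, then \<open>r > 0\<close>, and the left difference quotient of \<open>\<phi>\<close> at \<open>r\<close> is asymptotically at
  least \<open>K * \<phi> r\<close> by maximality and at most \<open>C * \<phi> r\<close> by the hypothesis on \<open>z'\<close>. No integration
  of \<open>E\<close>-valued functions is involved.

  For the comparison of \<open>u1\<close> with \<open>u2\<close> take \<open>z = u1 - u2\<close> and \<open>q = max u1 u2\<close>, which again lies
  between \<open>0\<close> and \<open>\<theta>\<close>. By the quasi-monotonicity of \<open>H v = \<kappa> * conv a v - v G v + p v\<close> and its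
  Lipschitz continuity one has \<open>H u1 - H u2 \<le> H q - H u2 \<le> C * \<phi>\<close>, since \<open>q - u2\<close> is the positive
  part of \<open>z\<close>; the remaining term \<open>- (m + p) z\<close> is negative where \<open>z > 0\<close>
  (\<open>comparison_derivative_bound\<close>).

  For the upper bound \<open>u \<le> \<theta>\<close> take \<open>z = u - \<theta>\<close> and \<open>q = min u \<theta>\<close>. Monotonicity is only known
  between \<open>0\<close> and \<open>\<theta>\<close>, so it is applied to \<open>q \<le> \<theta>\<close>: where \<open>u > \<theta>\<close> one has \<open>q = \<theta>\<close>, hence
  \<open>\<kappa> * conv a q - q G q \<le> \<kappa> \<theta> - \<theta> (\<kappa> - m) = m \<theta>\<close>. Passing from \<open>q\<close> to \<open>u\<close> costs at most a
  multiple of \<open>\<phi>\<close>, by the local Lipschitz condition on \<open>G\<close> and the boundedness of \<open>u\<close> on compact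
  time intervals (\<open>upper_derivative_bound\<close>). The statement on pairs of solutions follows by
  combining the two.
\<close>

section \<open>The function spaces through a filter\<close>

text \<open>
  The sense in which relations between elements of \<open>E\<close> hold: everywhere for the two spaces of
  continuous functions, almost everywhere for \<open>L\<^sup>\<infinity>\<close>. The order and the norm of \<open>E\<close> are then
  described uniformly by \<open>eventually\<close> with respect to this filter.
\<close>

definition E_filter :: "fspace \<Rightarrow> (real ^ 'n) filter" where
  "E_filter E = (case E of L_inf \<Rightarrow> ae_filter lebesgue | _ \<Rightarrow> top)"

lemma E_filter_simps [simp]:
  "E_filter C_ub = top" "E_filter C_b = top" "E_filter L_inf = ae_filter lebesgue"
  by (simp_all add: E_filter_def)

lemma E_filter_nontrivial [simp]: "E_filter E \<noteq> (bot :: (real ^ 'n) filter)"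
proof -
  have "emeasure (lebesgue :: (real ^ 'n) measure) (space lebesgue) \<noteq> 0"
    by simp
  then show ?thesis
    by (cases E) (auto simp: ae_filter_eq_bot_iff trivial_limit_def[of top])
qed

lemma E_le_iff: "E_le E f g \<longleftrightarrow> (\<forall>\<^sub>F x in E_filter E. f x \<le> g x)"
  by (cases E) auto

lemma E_eq_iff: "E_eq E f g \<longleftrightarrow> (\<forall>\<^sub>F x in E_filter E. f x = g x)"
  by (cases E) auto

lemma E_carrier_L_inf_iff:
  "f \<in> E_carrier L_inf \<longleftrightarrow>
     f \<in> borel_measurable lebesgue \<and> (\<exists>c. AE x in lebesgue. \<bar>f x\<bar> \<le> c)"
proof (cases "f \<in> borel_measurable lebesgue")
  case True
  then have m: "(\<lambda>x. ereal \<bar>f x\<bar>) \<in> borel_measurable lebesgue" by measurable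
  show ?thesis
  proof
    assume "f \<in> E_carrier L_inf"
    then have "esssup lebesgue (\<lambda>x. ereal \<bar>f x\<bar>) < \<infinity>" by simp
    then obtain c where c: "esssup lebesgue (\<lambda>x. ereal \<bar>f x\<bar>) < ereal c"
      using ereal_dense2 by blast
    have "AE x in lebesgue. \<bar>f x\<bar> \<le> c"
      using esssup_AE[of "\<lambda>x. ereal \<bar>f x\<bar>" lebesgue]
    proof eventually_elim
      case (elim x)
      then have "ereal \<bar>f x\<bar> < ereal c" using c by (rule le_less_trans)
      then show ?case by simp
    qed
    then show "f \<in> borel_measurable lebesgue \<and> (\<exists>c. AE x in lebesgue. \<bar>f x\<bar> \<le> c)"
      using True by blast
  next
    assume "f \<in> borel_measurable lebesgue \<and> (\<exists>c. AE x in lebesgue. \<bar>f x\<bar> \<le> c)"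
    then obtain c where "AE x in lebesgue. \<bar>f x\<bar> \<le> c" by blast
    then have "esssup lebesgue (\<lambda>x. ereal \<bar>f x\<bar>) \<le> ereal c"
      by (intro esssup_I m) auto
    then show "f \<in> E_carrier L_inf" using True by (auto simp: le_less_trans)
  qed
qed simp

lemma E_carrier_bounded:
  assumes "f \<in> E_carrier E"
  obtains c where "\<forall>\<^sub>F x in E_filter E. \<bar>f x\<bar> \<le> c"
proof (cases "E = L_inf")
  case True
  with assms that E_carrier_L_inf_iff[of f] show ?thesis by auto
next
  case False
  with assms obtain c where "\<bar>f x\<bar> \<le> c" for x
    by (cases E) (auto simp: bounded_iff)
  then show ?thesis by (intro that always_eventually) auto
qed

lemma E_carrier_measurable:
  assumes "f \<in> E_carrier E" shows "f \<in> borel_measurable lebesgue"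
  using assms
  by (cases E) (auto intro!: measurable_completion borel_measurable_continuous_onI
      uniformly_continuous_imp_continuous)

lemma E_norm_AE:
  assumes "f \<in> E_carrier E"
  shows "\<forall>\<^sub>F x in E_filter E. \<bar>f x\<bar> \<le> E_norm E f"
proof (cases "E = L_inf")
  case True
  let ?s = "esssup lebesgue (\<lambda>x. ereal \<bar>f x\<bar>)"
  have A: "AE x in lebesgue. ereal \<bar>f x\<bar> \<le> ?s" by (rule esssup_AE)
  have "?s < \<infinity>" using assms True by simp
  then have "\<bar>f x\<bar> \<le> real_of_ereal ?s" if "ereal \<bar>f x\<bar> \<le> ?s" for x
    using that by (cases ?s) auto
  with A True show ?thesis by (auto elim!: eventually_mono)
next
  case False
  with assms have "bounded (range f)" by (cases E) auto
  then have "bdd_above (range (\<lambda>x. \<bar>f x\<bar>))"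
    by (auto simp: bounded_iff bdd_above_def)
  then have "\<bar>f x\<bar> \<le> (SUP x. \<bar>f x\<bar>)" for x
    by (intro cSUP_upper) auto
  then show ?thesis using False by (cases E) auto
qed

lemma E_norm_leD:
  assumes "f \<in> E_carrier E" and "E_norm E f \<le> c"
  shows "\<forall>\<^sub>F x in E_filter E. \<bar>f x\<bar> \<le> c"
  using E_norm_AE[OF assms(1)] by eventually_elim (use assms(2) in linarith)

lemma E_norm_le:
  assumes "f \<in> E_carrier E" and "0 \<le> c" and c: "\<forall>\<^sub>F x in E_filter E. \<bar>f x\<bar> \<le> c"
  shows "E_norm E f \<le> c"
proof (cases "E = L_inf")
  case True
  have "f \<in> borel_measurable lebesgue" using assms(1) by (rule E_carrier_measurable)
  then have "(\<lambda>x. ereal \<bar>f x\<bar>) \<in> borel_measurable lebesgue" by measurable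
  then have "esssup lebesgue (\<lambda>x. ereal \<bar>f x\<bar>) \<le> ereal c"
    by (rule esssup_I) (use c True in auto)
  then show ?thesis
    using True \<open>0 \<le> c\<close> by (cases "esssup lebesgue (\<lambda>x. ereal \<bar>f x\<bar>)") auto
next
  case False
  with c show ?thesis by (cases E) (auto intro!: cSUP_least)
qed

lemma E_norm_nonneg:
  assumes "f \<in> E_carrier E" shows "0 \<le> E_norm E f"
proof -
  obtain x where "\<bar>f x\<bar> \<le> E_norm E f"
    using eventually_happens'[OF E_filter_nontrivial E_norm_AE[OF assms]] by blast
  then show ?thesis by linarith
qed

lemma E_carrier_const [simp]: "(\<lambda>x. c) \<in> E_carrier E"
proof (cases "E = L_inf")
  case True
  then show ?thesis by (simp only: E_carrier_L_inf_iff) auto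
qed (cases E; auto intro: uniformly_continuous_on_const)

lemma E_carrier_add:
  assumes "f \<in> E_carrier E" and "g \<in> E_carrier E"
  shows "(\<lambda>x. f x + g x) \<in> E_carrier E"
proof (cases "E = L_inf")
  case True
  obtain c where c: "\<forall>\<^sub>F x in E_filter E. \<bar>f x\<bar> \<le> c"
    using assms(1) by (rule E_carrier_bounded)
  obtain d where "\<forall>\<^sub>F x in E_filter E. \<bar>g x\<bar> \<le> d"
    using assms(2) by (rule E_carrier_bounded)
  with c have "\<forall>\<^sub>F x in E_filter E. \<bar>f x + g x\<bar> \<le> c + d"
    by eventually_elim linarith
  moreover have "(\<lambda>x. f x + g x) \<in> borel_measurable lebesgue"
    using assms[THEN E_carrier_measurable] by measurable
  ultimately show ?thesis
    unfolding True E_carrier_L_inf_iff E_filter_simps by blast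
next
  case False
  with assms show ?thesis
    by (cases E) (auto intro!: bounded_plus_comp uniformly_continuous_on_add continuous_on_add)
qed

lemma E_carrier_lipschitz:
  fixes h :: "real \<Rightarrow> real"
  assumes f: "f \<in> E_carrier E" and h: "\<And>y z. \<bar>h y - h z\<bar> \<le> L * \<bar>y - z\<bar>"
  shows "(\<lambda>x. h (f x)) \<in> E_carrier E"
proof -
  have L: "0 \<le> L" using h[of 0 1] by simp
  then have "L-lipschitz_on A h" for A
    using h by (auto intro!: lipschitz_onI simp: dist_real_def)
  then have uc: "uniformly_continuous_on A h" for A
    by (rule lipschitz_on_uniformly_continuous)
  then have cont: "continuous_on UNIV h" by (rule uniformly_continuous_imp_continuous)
  have b: "\<bar>h y\<bar> \<le> \<bar>h 0\<bar> + L * c" if "\<bar>y\<bar> \<le> c" for y c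
    using h[of y 0] mult_left_mono[OF that L] by simp
  show ?thesis
  proof (cases "E = L_inf")
    case True
    obtain c where "\<forall>\<^sub>F x in E_filter E. \<bar>f x\<bar> \<le> c" using f by (rule E_carrier_bounded)
    then have "\<forall>\<^sub>F x in E_filter E. \<bar>h (f x)\<bar> \<le> \<bar>h 0\<bar> + L * c"
      by eventually_elim (rule b)
    moreover have "(\<lambda>x. h (f x)) \<in> borel_measurable lebesgue"
      using f[THEN E_carrier_measurable] borel_measurable_continuous_onI[OF cont]
      by (rule measurable_compose)
    ultimately show ?thesis
      unfolding True E_carrier_L_inf_iff E_filter_simps by blast
  next
    case False
    with f obtain c where "\<And>x. \<bar>f x\<bar> \<le> c"
      by (cases E) (auto simp: bounded_iff)
    then have "bounded (range (\<lambda>x. h (f x)))"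
      using b by (auto simp: bounded_iff)
    moreover have "uniformly_continuous_on UNIV (\<lambda>x. h (f x))" if "uniformly_continuous_on UNIV f"
      using uniformly_continuous_on_compose[OF that uc] by auto
    moreover have "continuous_on UNIV (\<lambda>x. h (f x))" if "continuous_on UNIV f"
      using continuous_on_compose2[OF cont that] by auto
    ultimately show ?thesis using f False by (cases E) auto
  qed
qed

lemma E_carrier_cmult: "f \<in> E_carrier E \<Longrightarrow> (\<lambda>x. c * f x) \<in> E_carrier E"
  by (rule E_carrier_lipschitz[where h="\<lambda>y. c * y" and L="\<bar>c\<bar>"])
    (auto simp flip: abs_mult right_diff_distrib)

lemma E_carrier_diff:
  assumes "f \<in> E_carrier E" and "g \<in> E_carrier E"
  shows "(\<lambda>x. f x - g x) \<in> E_carrier E"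
  using E_carrier_add[OF assms(1) E_carrier_cmult[OF assms(2), of "-1"]] by simp

lemma E_carrier_pos_part: "f \<in> E_carrier E \<Longrightarrow> (\<lambda>x. max 0 (f x)) \<in> E_carrier E"
  by (rule E_carrier_lipschitz[where L=1]) auto

text \<open>The constant \<open>c\<close> makes this lemma cover both monotonicity and the triangle inequality.\<close>

lemma E_norm_le_add:
  assumes "f \<in> E_carrier E" "g \<in> E_carrier E" "\<forall>\<^sub>F x in E_filter E. \<bar>f x\<bar> \<le> c + \<bar>g x\<bar>"  "0 \<le> c"
  shows "E_norm E f \<le> c + E_norm E g"
proof (rule E_norm_le)
  show "\<forall>\<^sub>F x in E_filter E. \<bar>f x\<bar> \<le> c + E_norm E g"
    using assms(3) E_norm_AE[OF assms(2)] by eventually_elim linarith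
qed (use assms E_norm_nonneg[OF assms(2)] in auto)

section \<open>Convolution with a probability density\<close>

lemma lebesgue_reflect:
  fixes x :: "'a::euclidean_space"
  shows "distr lebesgue lebesgue (\<lambda>y. x - y) = lebesgue"
    and "(\<lambda>y. x - y) \<in> lebesgue \<rightarrow>\<^sub>M lebesgue"
proof -
  have T: "(\<lambda>y. x - y) = (\<lambda>y. x + (\<Sum>j\<in>Basis. (- 1 * (y \<bullet> j)) *\<^sub>R j))"
    by (auto simp: euclidean_representation sum_negf)
  show "distr lebesgue lebesgue (\<lambda>y. x - y) = lebesgue"
    using lebesgue_affine_euclidean[of "\<lambda>_. -1" x] by (simp add: T density_1)
  show "(\<lambda>y. x - y) \<in> lebesgue \<rightarrow>\<^sub>M lebesgue"
    using lebesgue_affine_measurable[of "\<lambda>_. -1" x] by (simp add: T)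
qed

lemma integrable_reflect:
  fixes a :: "'a::euclidean_space \<Rightarrow> real"
  assumes "integrable lebesgue a"
  shows "integrable lebesgue (\<lambda>y. a (x - y))"
    and "(LINT y|lebesgue. a (x - y)) = (LINT y|lebesgue. a y)"
    and "AE y in lebesgue. 0 \<le> a y \<Longrightarrow> AE y in lebesgue. 0 \<le> a (x - y)"
proof -
  note m = lebesgue_reflect(2)[of x] and d = lebesgue_reflect(1)[of x]
  have am: "a \<in> borel_measurable lebesgue" using assms by simp
  show "integrable lebesgue (\<lambda>y. a (x - y))"
    using integrable_distr_eq[OF m am] d assms by simp
  show "(LINT y|lebesgue. a (x - y)) = (LINT y|lebesgue. a y)"
    using integral_distr[OF m am] d by simp
  show "AE y in lebesgue. 0 \<le> a (x - y)" if "AE y in lebesgue. 0 \<le> a y"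
  proof -
    have "{y \<in> space lebesgue. 0 \<le> a y} \<in> sets lebesgue" using am by measurable
    from AE_distr_iff[OF m this] that show ?thesis unfolding d by blast
  qed
qed

lemma E_AE_lebesgue: "\<forall>\<^sub>F x in E_filter E. P x \<Longrightarrow> AE x in lebesgue. P x"
  by (cases E) auto

text \<open>
  Since \<open>a\<close> is nonnegative with integral \<open>1\<close>, convolution with \<open>a\<close> is monotone and commutes with
  adding constants. The bound holds at every point \<open>x\<close>, also for \<open>L\<^sup>\<infinity>\<close>.
\<close>

lemma conv_le_conv_add:
  assumes a: "integrable lebesgue a" "AE x in lebesgue. 0 \<le> a x" "(LINT x|lebesgue. a x) = 1"
    and v: "v \<in> E_carrier E" and w: "w \<in> E_carrier E"
    and le: "\<forall>\<^sub>F x in E_filter E. v x \<le> w x + c"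
  shows "conv a v x \<le> conv a w x + c"
proof -
  note k = integrable_reflect(1,2)[OF a(1), of x] integrable_reflect(3)[OF a(1,2), of x]
  have int: "integrable lebesgue (\<lambda>y. a (x - y) * f y)" if f: "f \<in> E_carrier E" for f
  proof -
    obtain b where "\<forall>\<^sub>F x in E_filter E. \<bar>f x\<bar> \<le> b" using f by (rule E_carrier_bounded)
    then have b: "AE y in lebesgue. \<bar>f y\<bar> \<le> b" by (rule E_AE_lebesgue)
    show ?thesis
    proof (rule Bochner_Integration.integrable_bound)
      show "integrable lebesgue (\<lambda>y. b * a (x - y))" using k(1) by simp
      show "(\<lambda>y. a (x - y) * f y) \<in> borel_measurable lebesgue"
        using k(1) E_carrier_measurable[OF f] by measurable
      show "AE y in lebesgue. norm (a (x - y) * f y) \<le> norm (b * a (x - y))"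
        using b k(3)
      proof eventually_elim
        case (elim y)
        then show ?case
          using mult_right_mono[of "\<bar>f y\<bar>" "\<bar>b\<bar>" "\<bar>a (x - y)\<bar>"] by (simp add: abs_mult mult.commute)
      qed
    qed
  qed
  have "conv a v x \<le> (LINT y|lebesgue. a (x - y) * w y + c * a (x - y))"
    unfolding conv_def
  proof (rule integral_mono_AE)
    show "AE y in lebesgue. a (x - y) * v y \<le> a (x - y) * w y + c * a (x - y)"
      using k(3) E_AE_lebesgue[OF le]
    proof eventually_elim
      case (elim y)
      then show ?case using mult_left_mono[of "v y" "w y + c" "a (x - y)"] by (simp add: algebra_simps)
    qed
  qed (use int v w k(1) in auto)
  also have "\<dots> = conv a w x + c"
    using int[OF w] k(1,2) a(3) by (simp add: conv_def)
  finally show ?thesis .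
qed

lemma conv_const:
  assumes a: "integrable lebesgue a" "(LINT x|lebesgue. a x) = 1"
  shows "conv a (\<lambda>_. c) x = c"
  using integrable_reflect(1,2)[OF a(1), of x] a(2) by (simp add: conv_def)

section \<open>Curves in the function spaces\<close>

lemma E_norm_triangle_diff:
  assumes "f \<in> E_carrier E" and "g \<in> E_carrier E"
  shows "E_norm E (\<lambda>x. f x - g x) \<le> E_norm E f + E_norm E g"
proof (rule E_norm_le_add)
  show "\<forall>\<^sub>F x in E_filter E. \<bar>f x - g x\<bar> \<le> E_norm E f + \<bar>g x\<bar>"
    using E_norm_AE[OF assms(1)] by eventually_elim linarith
qed (use assms E_norm_nonneg E_carrier_diff in auto)

lemma E_norm_diff_tendsto_0:
  assumes "((\<lambda>s. E_norm E (f s)) \<longlongrightarrow> 0) F" and "((\<lambda>s. E_norm E (g s)) \<longlongrightarrow> 0) F"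
    and "\<forall>\<^sub>F s in F. f s \<in> E_carrier E \<and> g s \<in> E_carrier E"
  shows "((\<lambda>s. E_norm E (\<lambda>x. f s x - g s x)) \<longlongrightarrow> 0) F"
proof (rule Lim_null_comparison)
  show "\<forall>\<^sub>F s in F. norm (E_norm E (\<lambda>x. f s x - g s x)) \<le> E_norm E (f s) + E_norm E (g s)"
    using assms(3)
    by eventually_elim (simp add: E_norm_triangle_diff E_norm_nonneg E_carrier_diff)
  show "((\<lambda>s. E_norm E (f s) + E_norm E (g s)) \<longlongrightarrow> 0) F"
    using tendsto_add[OF assms(1,2)] by simp
qed

lemma E_continuous_on_diff:
  assumes "E_continuous_on E S u" and "E_continuous_on E S v"
  shows "E_continuous_on E S (\<lambda>t x. u t x - v t x)"
  unfolding E_continuous_on_def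
proof (intro conjI ballI)
  fix t assume t: "t \<in> S"
  have "((\<lambda>s. E_norm E (\<lambda>x. (u s x - u t x) - (v s x - v t x))) \<longlongrightarrow> 0) (at t within S)"
  proof (rule E_norm_diff_tendsto_0)
    show "\<forall>\<^sub>F s in at t within S. (\<lambda>x. u s x - u t x) \<in> E_carrier E \<and>
        (\<lambda>x. v s x - v t x) \<in> E_carrier E"
      using assms t unfolding eventually_at_filter
      by (auto simp: E_continuous_on_def intro!: always_eventually E_carrier_diff)
  qed (use assms t in \<open>auto simp: E_continuous_on_def\<close>)
  then show "((\<lambda>s. E_norm E (\<lambda>x. u s x - v s x - (u t x - v t x))) \<longlongrightarrow> 0) (at t within S)"
    by (simp add: algebra_simps)
qed (use assms in \<open>auto simp: E_continuous_on_def intro!: E_carrier_diff\<close>)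

lemma E_continuous_on_const: "c \<in> E_carrier E \<Longrightarrow> E_continuous_on E S (\<lambda>_. c)"
  by (cases E) (auto simp: E_continuous_on_def esssup_const zero_ereal_def[symmetric])

lemma E_C1_on_quotient_carrier:
  assumes "E_C1_on E S u u'" "s \<in> S" "t \<in> S"
  shows "(\<lambda>x. (u s x - u t x) / (s - t) - u' t x) \<in> E_carrier E"
proof -
  have "(\<lambda>x. inverse (s - t) * (u s x - u t x)) \<in> E_carrier E"
    using assms by (auto intro!: E_carrier_cmult E_carrier_diff simp: E_C1_on_def)
  then show ?thesis
    using assms E_carrier_diff[of _ E "u' t"]
    by (auto simp: E_C1_on_def E_continuous_on_def divide_inverse mult.commute)
qed

lemma E_C1_on_diff:
  assumes u: "E_C1_on E S u u'" and v: "E_C1_on E S v v'"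
  shows "E_C1_on E S (\<lambda>t x. u t x - v t x) (\<lambda>t x. u' t x - v' t x)"
  unfolding E_C1_on_def
proof (intro conjI ballI)
  fix t assume t: "t \<in> S"
  have "((\<lambda>s. E_norm E (\<lambda>x. ((u s x - u t x) / (s - t) - u' t x)
      - ((v s x - v t x) / (s - t) - v' t x))) \<longlongrightarrow> 0) (at t within S)"
  proof (rule E_norm_diff_tendsto_0)
    show "\<forall>\<^sub>F s in at t within S. (\<lambda>x. (u s x - u t x) / (s - t) - u' t x) \<in> E_carrier E \<and>
        (\<lambda>x. (v s x - v t x) / (s - t) - v' t x) \<in> E_carrier E"
      using E_C1_on_quotient_carrier[OF u _ t] E_C1_on_quotient_carrier[OF v _ t]
      by (auto simp: eventually_at_filter intro!: always_eventually)
  qed (use u v t in \<open>auto simp: E_C1_on_def\<close>)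
  then show "((\<lambda>s. E_norm E (\<lambda>x. (u s x - v s x - (u t x - v t x)) / (s - t) - (u' t x - v' t x)))
      \<longlongrightarrow> 0) (at t within S)"
    by (simp add: diff_divide_distrib add_divide_distrib algebra_simps)
next
  show "E_continuous_on E S (\<lambda>t x. u' t x - v' t x)"
    using u v E_continuous_on_diff by (auto simp: E_C1_on_def)
qed (use u v in \<open>auto simp: E_C1_on_def intro!: E_carrier_diff\<close>)

lemma E_continuous_on_subset: "E_continuous_on E S u \<Longrightarrow> S' \<subseteq> S \<Longrightarrow> E_continuous_on E S' u"
  unfolding E_continuous_on_def by (meson subsetD tendsto_within_subset)

lemma E_C1_on_subset: "E_C1_on E S u u' \<Longrightarrow> S' \<subseteq> S \<Longrightarrow> E_C1_on E S' u u'"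
  unfolding E_C1_on_def using E_continuous_on_subset by (meson subsetD tendsto_within_subset)

text \<open>
  Used for \<open>h\<close> the identity and the positive part.
\<close>

lemma continuous_on_E_norm:
  assumes u: "E_continuous_on E S u" and h: "\<And>y z. \<bar>h y - h z\<bar> \<le> \<bar>y - z\<bar>"
  shows "continuous_on S (\<lambda>t. E_norm E (\<lambda>x. h (u t x)))"
  unfolding continuous_on_def
proof
  fix t assume t: "t \<in> S"
  have hu: "(\<lambda>x. h (u s x)) \<in> E_carrier E" if "s \<in> S" for s
    using u that h E_carrier_lipschitz[of "u s" E h 1] by (auto simp: E_continuous_on_def)
  have du: "(\<lambda>x. u s x - u r x) \<in> E_carrier E" if "s \<in> S" "r \<in> S" for s r
    using u that by (auto simp: E_continuous_on_def intro: E_carrier_diff)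
  have le: "E_norm E (\<lambda>x. h (u s x)) \<le> E_norm E (\<lambda>x. u q x - u p x) + E_norm E (\<lambda>x. h (u r x))"
    if "s \<in> S" "r \<in> S" and "(p = r \<and> q = s) \<or> (p = s \<and> q = r)" for s r p q
  proof -
    have q: "(\<lambda>x. u q x - u p x) \<in> E_carrier E" using that du by auto
    have "\<forall>\<^sub>F x in E_filter E. \<bar>h (u s x)\<bar> \<le> E_norm E (\<lambda>x. u q x - u p x) + \<bar>h (u r x)\<bar>"
      using E_norm_AE[OF q]
    proof eventually_elim
      case (elim x)
      then show ?case using h[of "u s x" "u r x"] that(3) by auto
    qed
    then show ?thesis
      using that hu q E_norm_nonneg[OF q] by (intro E_norm_le_add) auto
  qed
  have "((\<lambda>s. E_norm E (\<lambda>x. h (u s x)) - E_norm E (\<lambda>x. h (u t x))) \<longlongrightarrow> 0) (at t within S)"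
  proof (rule Lim_null_comparison)
    show "\<forall>\<^sub>F s in at t within S. norm (E_norm E (\<lambda>x. h (u s x)) - E_norm E (\<lambda>x. h (u t x)))
        \<le> E_norm E (\<lambda>x. u s x - u t x)"
      unfolding eventually_at_filter
    proof (intro always_eventually allI impI)
      fix s assume "s \<in> S"
      then show "norm (E_norm E (\<lambda>x. h (u s x)) - E_norm E (\<lambda>x. h (u t x)))
          \<le> E_norm E (\<lambda>x. u s x - u t x)"
        using le[of s t t s] le[of t s t s] t by (simp add: abs_le_iff)
    qed
    show "((\<lambda>s. E_norm E (\<lambda>x. u s x - u t x)) \<longlongrightarrow> 0) (at t within S)"
      using u t by (auto simp: E_continuous_on_def)
  qed
  then show "((\<lambda>s. E_norm E (\<lambda>x. h (u s x))) \<longlongrightarrow> E_norm E (\<lambda>x. h (u t x))) (at t within S)"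
    by (rule LIM_zero_cancel)
qed

section \<open>A maximum principle\<close>

text \<open>
  The derivative \<open>z'\<close> is only controlled at the points where \<open>z\<close> is positive, and only by the norm
  of the positive part of \<open>z\<close> at the same time.
\<close>

lemma nonpos_of_derivative_bound:
  assumes "0 < T" and cont: "E_continuous_on E {0..T} z" and C1: "E_C1_on E {0<..T} z z'"
    and init: "E_le E (z 0) (\<lambda>x. 0)" and C: "0 \<le> C"
    and bound: "\<And>t. t \<in> {0<..T} \<Longrightarrow> \<forall>\<^sub>F x in E_filter E.
      0 < z t x \<longrightarrow> z' t x \<le> C * E_norm E (\<lambda>x. max 0 (z t x))"
    and t: "t \<in> {0..T}"
  shows "E_le E (z t) (\<lambda>x. 0)"
proof -
  define \<phi> where "\<phi> t = E_norm E (\<lambda>x. max 0 (z t x))" for t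
  define K where "K = C + 1"
  have pos: "(\<lambda>x. max 0 (z s x)) \<in> E_carrier E" if "s \<in> {0..T}" for s
    using that cont by (auto simp: E_continuous_on_def intro!: E_carrier_pos_part)
  have \<phi>0: "0 \<le> \<phi> s" if "s \<in> {0..T}" for s
    unfolding \<phi>_def by (rule E_norm_nonneg[OF pos[OF that]])
  have le\<phi>: "\<forall>\<^sub>F x in E_filter E. z s x \<le> \<phi> s" if "s \<in> {0..T}" for s
    using E_norm_AE[OF pos[OF that]] unfolding \<phi>_def by eventually_elim linarith
  have "continuous_on {0..T} \<phi>"
    unfolding \<phi>_def by (rule continuous_on_E_norm[OF cont]) linarith
  then have "continuous_on {0..T} (\<lambda>s. exp (- K * s) * \<phi> s)"
    by (intro continuous_intros)
  then obtain r where r: "r \<in> {0..T}"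
    and max: "\<And>s. s \<in> {0..T} \<Longrightarrow> exp (- K * s) * \<phi> s \<le> exp (- K * r) * \<phi> r"
    using continuous_attains_sup[of "{0..T}" "\<lambda>s. exp (- K * s) * \<phi> s"] \<open>0 < T\<close> by auto
  have "\<phi> r \<le> 0"
  proof (rule ccontr)
    assume "\<not> \<phi> r \<le> 0"
    then have r\<phi>: "0 < \<phi> r" by simp
    have "\<phi> 0 \<le> 0"
      unfolding \<phi>_def using init pos[of 0] \<open>0 < T\<close>
      by (intro E_norm_le) (auto simp: E_le_iff elim!: eventually_mono)
    with r r\<phi> have r0: "r \<in> {0<..T}" by (cases "r = 0") auto
    \<comment> \<open>With \<open>K = C + 1\<close>, half of the gap between \<open>K * \<phi> r\<close> and \<open>C * \<phi> r\<close> is left as error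
      for the difference quotient.\<close>
    define \<epsilon> where "\<epsilon> = \<phi> r / 2"
    have \<epsilon>: "0 < \<epsilon>" using r\<phi> by (simp add: \<epsilon>_def)
    have "\<forall>\<^sub>F s in at r within {0<..T}. E_norm E (\<lambda>x. (z s x - z r x) / (s - r) - z' r x) < \<epsilon>"
      using C1 r0 \<epsilon> by (intro order_tendstoD(2)[where y=0]) (auto simp: E_C1_on_def)
    then obtain d where d: "0 < d" and quot: "\<And>s. s \<in> {0<..T} \<Longrightarrow> s \<noteq> r \<Longrightarrow> \<bar>s - r\<bar> < d \<Longrightarrow>
        E_norm E (\<lambda>x. (z s x - z r x) / (s - r) - z' r x) < \<epsilon>"
      by (auto simp: eventually_at dist_real_def)
    \<comment> \<open>The last bound on the step absorbs the second-order error in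
      \<open>exp (- (K * h)) \<le> 1 / (1 + K * h)\<close>.\<close>
    define h where "h = Min {d / 2, r / 2, 1 / (2 * K\<^sup>2)}"
    have K: "1 \<le> K" using C by (simp add: K_def)
    have h: "0 < h" "h < d" "h < r" "h \<le> 1 / (2 * K\<^sup>2)"
      using d r0 K by (auto simp: h_def)
    have s: "r - h \<in> {0<..T}" "r - h \<in> {0..T}" using h r0 by auto
    have "0 \<le> h * (C * \<phi> r + \<epsilon>)" using h(1) C r\<phi> \<epsilon> by simp
    with \<phi>0[OF s(2)] have B: "0 \<le> \<phi> (r - h) + h * (C * \<phi> r + \<epsilon>)" by linarith
    \<comment> \<open>The left difference quotient at \<open>r\<close> is close to \<open>z' r\<close>, which is at most \<open>C * \<phi> r\<close> where
      \<open>z r\<close> is positive.\<close>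
    have "\<forall>\<^sub>F x in E_filter E. z r x \<le> \<phi> (r - h) + h * (C * \<phi> r + \<epsilon>)"
      using E_norm_AE[OF E_C1_on_quotient_carrier[OF C1 s(1) r0]] le\<phi>[OF s(2)] bound[OF r0]
    proof eventually_elim
      case (elim x)
      show ?case
      proof (cases "0 < z r x")
        case True
        have "(z (r - h) x - z r x) / (- h) - z' r x < \<epsilon>"
          using elim(1) quot[of "r - h"] s(1) h by auto
        then have "(z r x - z (r - h) x) / h < C * \<phi> r + \<epsilon>"
          using elim(3) True unfolding \<phi>_def by (simp add: diff_divide_distrib)
        then have "z r x - z (r - h) x < h * (C * \<phi> r + \<epsilon>)"
          using h(1) by (simp add: pos_divide_less_eq mult.commute)
        with elim(2) show ?thesis by linarith
      next
        case False
        with B show ?thesis by linarith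
      qed
    qed
    then have "\<phi> r \<le> \<phi> (r - h) + h * (C * \<phi> r + \<epsilon>)"
      using E_norm_le[OF pos[OF r] B] B unfolding \<phi>_def[of r]
      by (auto elim!: eventually_mono)
    \<comment> \<open>Maximality of \<open>r\<close> gives the opposite bound.\<close>
    also have "\<phi> (r - h) \<le> exp (- (K * h)) * \<phi> r"
    proof -
      have "exp (- K * (r - h)) * \<phi> (r - h) \<le> exp (- K * r) * \<phi> r" by (rule max[OF s(2)])
      also have "\<dots> = exp (- K * (r - h)) * (exp (- (K * h)) * \<phi> r)"
        by (simp add: right_diff_distrib mult_exp_exp flip: mult.assoc)
      finally show ?thesis by simp
    qed
    also have "exp (- (K * h)) \<le> 1 / (1 + K * h)"
      using exp_ge_add_one_self[of "K * h"] h(1) K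
      by (simp add: exp_minus inverse_eq_divide frac_le add_pos_nonneg)
    finally have "\<phi> r \<le> \<phi> r * (1 / (1 + K * h) + h * (K - 1 / 2))"
      using r\<phi> by (simp add: \<epsilon>_def K_def algebra_simps)
    then have "1 \<le> 1 / (1 + K * h) + h * (K - 1 / 2)"
      using r\<phi> by simp
    moreover have "0 < 1 + K * h" using h(1) K by (simp add: add_pos_nonneg)
    ultimately have "1 + K * h \<le> 1 + h * (K - 1 / 2) * (1 + K * h)"
      by (simp add: field_simps)
    then have "h * K \<le> h * ((K - 1 / 2) * (1 + K * h))" by (simp add: algebra_simps)
    then have "K \<le> (K - 1 / 2) * (1 + K * h)" using h(1) by simp
    also have "\<dots> = K - 1 / 2 + K\<^sup>2 * h - K * h / 2" by (simp add: algebra_simps power2_eq_square)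
    also have "\<dots> < K - 1 / 2 + K\<^sup>2 * h" using h(1) K by simp
    also have "K\<^sup>2 * h \<le> 1 / 2" using h(4) K by (simp add: field_simps)
    finally show False by simp
  qed
  then have "exp (- K * t) * \<phi> t \<le> 0"
    using max[OF t] by (smt (verit) mult_nonneg_nonpos exp_ge_zero)
  then have "\<phi> t \<le> 0" by (simp add: mult_le_0_iff)
  then show ?thesis
    using le\<phi>[OF t] unfolding E_le_iff by (auto elim!: eventually_mono)
qed

section \<open>The nonlocal equation\<close>

lemma E_between_iff:
  "v \<in> E_between E r \<longleftrightarrow> v \<in> E_carrier E \<and> (\<forall>\<^sub>F x in E_filter E. 0 \<le> v x \<and> v x \<le> r)"
  by (auto simp: E_between_def E_le_iff eventually_conj_iff)

text \<open>
  The hypotheses on the equation, with fixed Lipschitz constant \<open>l\<close> and shift \<open>p\<close>, written through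
  \<open>E_filter\<close>. Of the bounds on \<open>G\<close>, only \<open>G v \<ge> 0\<close> and the value \<open>\<kappa> - m\<close> of \<open>G\<close> at the constant
  \<open>\<theta>\<close> are retained.
\<close>

locale monotone_reaction =
  fixes E :: fspace and m \<kappa> \<theta> l p :: real
    and a :: "real ^ 'n \<Rightarrow> real" and G :: "(real ^ 'n \<Rightarrow> real) \<Rightarrow> (real ^ 'n \<Rightarrow> real)"
  assumes m: "0 < m" and \<kappa>: "0 < \<kappa>" and \<theta>: "0 < \<theta>" and l: "0 < l" and p: "0 \<le> p"
    and a: "integrable lebesgue a" "AE x in lebesgue. 0 \<le> a x" "(LINT x|lebesgue. a x) = 1"
    and G_carrier: "v \<in> E_carrier E \<Longrightarrow> G v \<in> E_carrier E"
    and G_nonneg: "v \<in> E_between E \<theta> \<Longrightarrow> \<forall>\<^sub>F x in E_filter E. 0 \<le> G v x"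
    and G_\<theta>: "\<forall>\<^sub>F x in E_filter E. G (\<lambda>_. \<theta>) x = \<kappa> - m"
    and G_lipschitz: "\<lbrakk>v \<in> E_between E \<theta>; w \<in> E_between E \<theta>\<rbrakk> \<Longrightarrow>
      E_norm E (\<lambda>x. G v x - G w x) \<le> l * E_norm E (\<lambda>x. v x - w x)"
    and quasi_mono: "\<lbrakk>v \<in> E_between E \<theta>; w \<in> E_between E \<theta>; \<forall>\<^sub>F x in E_filter E. v x \<le> w x\<rbrakk> \<Longrightarrow>
      \<forall>\<^sub>F x in E_filter E. \<kappa> * conv a v x - v x * G v x + p * v x
                          \<le> \<kappa> * conv a w x - w x * G w x + p * w x"
begin

text \<open>
  At a fixed time: \<open>v\<close>, \<open>w\<close> are the values of a subsolution and a supersolution, and \<open>v'\<close>, \<open>w'\<close>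
  their time derivatives.
\<close>

lemma comparison_derivative_bound:
  assumes v: "v \<in> E_between E \<theta>" and w: "w \<in> E_between E \<theta>"
    and le: "\<forall>\<^sub>F x in E_filter E. v' x - \<kappa> * conv a v x + m * v x + v x * G v x
                              \<le> w' x - \<kappa> * conv a w x + m * w x + w x * G w x"
  shows "\<forall>\<^sub>F x in E_filter E. 0 < v x - w x \<longrightarrow>
    v' x - w' x \<le> (\<kappa> + \<theta> * l + p) * E_norm E (\<lambda>x. max 0 (v x - w x))"
proof -
  define n where "n = E_norm E (\<lambda>x. max 0 (v x - w x))"
  \<comment> \<open>This is \<open>max (v x) (w x)\<close>, written so that \<open>q - w\<close> is visibly the positive part of
    \<open>v - w\<close>.\<close>
  define q where "q x = w x + max 0 (v x - w x)" for x
  have pos: "(\<lambda>x. max 0 (v x - w x)) \<in> E_carrier E"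
    using v w by (intro E_carrier_pos_part E_carrier_diff) (auto simp: E_between_iff)
  have le_n: "\<forall>\<^sub>F x in E_filter E. max 0 (v x - w x) \<le> n"
    using E_norm_AE[OF pos] unfolding n_def by eventually_elim linarith
  have v_range: "\<forall>\<^sub>F x in E_filter E. 0 \<le> v x \<and> v x \<le> \<theta>"
    and w_range: "\<forall>\<^sub>F x in E_filter E. 0 \<le> w x \<and> w x \<le> \<theta>"
    using v w by (simp_all add: E_between_iff)
  then have q_range: "\<forall>\<^sub>F x in E_filter E. 0 \<le> q x \<and> q x \<le> \<theta>"
    unfolding q_def by eventually_elim auto
  then have q: "q \<in> E_between E \<theta>"
    using w E_carrier_add[OF _ pos, of w] by (simp add: E_between_iff q_def[abs_def])
  have "(\<lambda>x. G q x - G w x) \<in> E_carrier E"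
    using q w by (intro E_carrier_diff G_carrier) (auto simp: E_between_iff)
  moreover have "E_norm E (\<lambda>x. G q x - G w x) \<le> l * n"
    using G_lipschitz[OF q w] by (simp add: q_def n_def)
  ultimately have G_diff: "\<forall>\<^sub>F x in E_filter E. \<bar>G q x - G w x\<bar> \<le> l * n"
    by (rule E_norm_leD)
  have conv: "conv a q x \<le> conv a w x + n" for x
    by (rule conv_le_conv_add[OF a, of q E w])
      (use q w le_n in \<open>auto simp: E_between_iff q_def elim!: eventually_mono\<close>)
  have mono: "\<forall>\<^sub>F x in E_filter E. \<kappa> * conv a v x - v x * G v x + p * v x
                                \<le> \<kappa> * conv a q x - q x * G q x + p * q x"
    by (rule quasi_mono[OF v q]) (simp add: q_def max_def)
  from le mono G_diff G_nonneg[OF w] q_range le_n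
  have "\<forall>\<^sub>F x in E_filter E. 0 < v x - w x \<longrightarrow> v' x - w' x \<le> (\<kappa> + \<theta> * l + p) * n"
  proof eventually_elim
    case (elim x)
    show ?case
    proof
      assume pos: "0 < v x - w x"
      then have qv: "q x = v x" by (simp add: q_def)
      have "v x * (G w x - G q x) \<le> v x * (l * n)"
        using elim(3,5) qv by (intro mult_left_mono) auto
      moreover have "v x * (l * n) \<le> \<theta> * (l * n)"
        using elim(3,5) qv by (intro mult_right_mono) auto
      moreover have "0 \<le> (v x - w x) * G w x" using pos elim(4) by simp
      moreover have "p * (v x - w x) \<le> p * n" using elim(6) p by (intro mult_left_mono) auto
      moreover have "\<kappa> * conv a q x \<le> \<kappa> * (conv a w x + n)" using conv \<kappa> by simp
      moreover have "0 \<le> (m + p) * (v x - w x)" using m p pos by simp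
      ultimately show "v' x - w' x \<le> (\<kappa> + \<theta> * l + p) * n"
        using elim(1,2) unfolding qv by (simp add: algebra_simps)
    qed
  qed
  then show ?thesis by (simp add: n_def)
qed

lemma comparison:
  assumes "0 < T"
    and u1: "E_continuous_on E {0..T} u1" "E_C1_on E {0<..T} u1 u1'"
    and u2: "E_continuous_on E {0..T} u2" "E_C1_on E {0<..T} u2 u2'"
    and le: "\<And>t. t \<in> {0<..T} \<Longrightarrow> \<forall>\<^sub>F x in E_filter E.
          u1' t x - \<kappa> * conv a (u1 t) x + m * u1 t x + u1 t x * G (u1 t) x
        \<le> u2' t x - \<kappa> * conv a (u2 t) x + m * u2 t x + u2 t x * G (u2 t) x"
    and range: "\<And>t. t \<in> {0<..T} \<Longrightarrow> u1 t \<in> E_between E \<theta> \<and> u2 t \<in> E_between E \<theta>"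
    and init: "E_le E (u1 0) (u2 0)"
    and t: "t \<in> {0..T}"
  shows "E_le E (u1 t) (u2 t)"
proof -
  have "E_le E (\<lambda>x. u1 t x - u2 t x) (\<lambda>x. 0)"
  proof (rule nonpos_of_derivative_bound[OF \<open>0 < T\<close> E_continuous_on_diff[OF u1(1) u2(1)]
        E_C1_on_diff[OF u1(2) u2(2)] _ _ _ t])
    show "E_le E (\<lambda>x. u1 0 x - u2 0 x) (\<lambda>x. 0)" using init by (simp add: E_le_iff)
    show "0 \<le> \<kappa> + \<theta> * l + p" using \<kappa> \<theta> l p by (simp add: add_nonneg_nonneg)
    show "\<forall>\<^sub>F x in E_filter E. 0 < u1 t x - u2 t x \<longrightarrow> u1' t x - u2' t x
        \<le> (\<kappa> + \<theta> * l + p) * E_norm E (\<lambda>x. max 0 (u1 t x - u2 t x))" if "t \<in> {0<..T}" for t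
      using range[OF that] le[OF that] by (intro comparison_derivative_bound) auto
  qed
  then show ?thesis by (simp add: E_le_iff)
qed

text \<open>
  At a fixed time: \<open>v\<close> is the value of a solution, possibly exceeding \<open>\<theta>\<close>, and \<open>v'\<close> its time
  derivative.
\<close>

lemma upper_derivative_bound:
  assumes v: "v \<in> E_between E R" and R: "\<theta> \<le> R" and L: "0 \<le> L"
    and lip: "\<And>w. w \<in> E_between E R \<Longrightarrow>
      E_norm E (\<lambda>x. G v x - G w x) \<le> L * E_norm E (\<lambda>x. v x - w x)"
    and eq: "\<forall>\<^sub>F x in E_filter E. v' x = \<kappa> * conv a v x - m * v x - v x * G v x"
  shows "\<forall>\<^sub>F x in E_filter E. 0 < v x - \<theta> \<longrightarrow>
    v' x \<le> (\<kappa> + R * L) * E_norm E (\<lambda>x. max 0 (v x - \<theta>))"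
proof -
  define n where "n = E_norm E (\<lambda>x. max 0 (v x - \<theta>))"
  \<comment> \<open>This is \<open>min (v x) \<theta>\<close>, written so that \<open>v - q\<close> is visibly the positive part of
    \<open>v - \<theta>\<close>.\<close>
  define q where "q x = v x - max 0 (v x - \<theta>)" for x
  have pos: "(\<lambda>x. max 0 (v x - \<theta>)) \<in> E_carrier E"
    using v by (intro E_carrier_pos_part E_carrier_diff) (auto simp: E_between_iff)
  have le_n: "\<forall>\<^sub>F x in E_filter E. max 0 (v x - \<theta>) \<le> n"
    using E_norm_AE[OF pos] unfolding n_def by eventually_elim linarith
  have q: "q \<in> E_between E \<theta>"
    using v \<theta> E_carrier_diff[OF _ pos, of v]
    by (auto simp: E_between_iff q_def[abs_def] elim!: eventually_mono)
  then have qR: "q \<in> E_between E R"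
    using R by (auto simp: E_between_iff elim!: eventually_mono)
  have c\<theta>: "(\<lambda>_. \<theta>) \<in> E_between E \<theta>" using \<theta> by (simp add: E_between_iff)
  have "(\<lambda>x. G v x - G q x) \<in> E_carrier E"
    using q v by (intro E_carrier_diff G_carrier) (auto simp: E_between_iff)
  moreover have "E_norm E (\<lambda>x. G v x - G q x) \<le> L * n"
    using lip[OF qR] by (simp add: q_def n_def)
  ultimately have G_diff: "\<forall>\<^sub>F x in E_filter E. \<bar>G v x - G q x\<bar> \<le> L * n"
    by (rule E_norm_leD)
  have conv: "conv a v x \<le> conv a q x + n" for x
    by (rule conv_le_conv_add[OF a, of v E q])
      (use q v le_n in \<open>auto simp: E_between_iff q_def elim!: eventually_mono\<close>)
  have mono: "\<forall>\<^sub>F x in E_filter E. \<kappa> * conv a q x - q x * G q x + p * q x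
                                \<le> \<kappa> * \<theta> - \<theta> * G (\<lambda>_. \<theta>) x + p * \<theta>"
    using quasi_mono[OF q c\<theta>] q by (auto simp: conv_const[OF a(1,3)] E_between_iff eventually_conj_iff)
  have v_range: "\<forall>\<^sub>F x in E_filter E. 0 \<le> v x \<and> v x \<le> R" using v by (simp add: E_between_iff)
  from eq mono G_diff G_nonneg[OF q] G_\<theta> v_range
  have "\<forall>\<^sub>F x in E_filter E. 0 < v x - \<theta> \<longrightarrow> v' x \<le> (\<kappa> + R * L) * n"
  proof eventually_elim
    case (elim x)
    show ?case
    proof
      assume pos: "0 < v x - \<theta>"
      then have q\<theta>: "q x = \<theta>" by (simp add: q_def)
      have "v x * (G q x - G v x) \<le> v x * (L * n)"
        using elim(3,6) by (intro mult_left_mono) auto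
      moreover have "v x * (L * n) \<le> R * (L * n)"
        using elim(3,6) by (intro mult_right_mono) auto
      moreover have "0 \<le> (v x - \<theta>) * G q x" using pos elim(4) by simp
      moreover have "\<kappa> * conv a v x \<le> \<kappa> * (conv a q x + n)" using conv \<kappa> by simp
      moreover have "0 \<le> m * (v x - \<theta>)" using m pos by simp
      ultimately show "v' x \<le> (\<kappa> + R * L) * n"
        using elim(1,2) unfolding q\<theta> elim(5) by (simp add: algebra_simps)
    qed
  qed
  then show ?thesis by (simp add: n_def)
qed

lemma solution_le_\<theta>:
  assumes ex: "existence_hypotheses E G" and sol: "nonneg_classical_solution E \<kappa> m a G u0 u"
    and init: "E_le E u0 (\<lambda>x. \<theta>)" and t: "0 \<le> t"
  shows "E_le E (u t) (\<lambda>x. \<theta>)"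
proof -
  obtain u' where cont: "E_continuous_on E {0..} u" and C1: "E_C1_on E {0<..} u u'"
    and eq: "\<And>t. 0 < t \<Longrightarrow>
      E_eq E (u' t) (\<lambda>x. \<kappa> * conv a (u t) x - m * u t x - u t x * G (u t) x)"
    and u0: "E_eq E (u 0) u0" and nonneg: "\<And>t. 0 \<le> t \<Longrightarrow> E_le E (\<lambda>x. 0) (u t)"
    using sol by (auto simp: nonneg_classical_solution_def classical_solution_def)
  \<comment> \<open>Any \<open>T > 0\<close> with \<open>T \<ge> t\<close> would do; the increment covers \<open>t = 0\<close>.\<close>
  define T where "T = t + 1"
  have T: "0 < T" "t \<in> {0..T}" using t by (auto simp: T_def)
  have contT: "E_continuous_on E {0..T} u" and C1T: "E_C1_on E {0<..T} u u'"
    using cont C1 by (auto intro: E_continuous_on_subset E_C1_on_subset)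
  have "continuous_on {0..T} (\<lambda>t. E_norm E (\<lambda>x. u t x))"
    using continuous_on_E_norm[OF contT, of "\<lambda>y. y"] by simp
  then obtain s where "\<forall>r\<in>{0..T}. E_norm E (u r) \<le> E_norm E (u s)"
    using continuous_attains_sup[of "{0..T}" "\<lambda>t. E_norm E (u t)"] T(1) by auto
  then have s: "E_norm E (u r) \<le> E_norm E (u s)" if "r \<in> {0..T}" for r
    using that by blast
  define R where "R = max \<theta> (E_norm E (u s))"
  have R: "\<theta> \<le> R" "0 < R" using \<theta> by (auto simp: R_def)
  have range: "u r \<in> E_between E R" if r: "r \<in> {0..T}" for r
  proof -
    have c: "u r \<in> E_carrier E" using contT r by (auto simp: E_continuous_on_def)
    have "\<forall>\<^sub>F x in E_filter E. 0 \<le> u r x" using nonneg[of r] r by (simp add: E_le_iff)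
    with E_norm_AE[OF c] have "\<forall>\<^sub>F x in E_filter E. 0 \<le> u r x \<and> u r x \<le> R"
      by eventually_elim (use s[OF r] in \<open>auto simp: R_def\<close>)
    with c show ?thesis by (simp add: E_between_iff)
  qed
  obtain k where k: "\<And>r v w. \<lbrakk>0 < r; v \<in> E_between E r; w \<in> E_between E r\<rbrakk> \<Longrightarrow>
      E_norm E (\<lambda>x. G v x - G w x) \<le> exp (k * r) * E_norm E (\<lambda>x. v x - w x)"
    using ex unfolding existence_hypotheses_def by blast
  have "E_le E (\<lambda>x. u t x - \<theta>) (\<lambda>x. 0)"
  proof (rule nonpos_of_derivative_bound[OF T(1) _ _ _ _ _ T(2)])
    show "E_continuous_on E {0..T} (\<lambda>t x. u t x - \<theta>)"
      by (rule E_continuous_on_diff[OF contT E_continuous_on_const]) simp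
    show "E_C1_on E {0<..T} (\<lambda>t x. u t x - \<theta>) u'"
      using C1T by (simp add: E_C1_on_def E_carrier_diff)
    show "E_le E (\<lambda>x. u 0 x - \<theta>) (\<lambda>x. 0)"
      using u0 init unfolding E_le_iff E_eq_iff by eventually_elim simp
    show "0 \<le> \<kappa> + R * exp (k * R)" using \<kappa> R by simp
    show "\<forall>\<^sub>F x in E_filter E. 0 < u r x - \<theta> \<longrightarrow>
        u' r x \<le> (\<kappa> + R * exp (k * R)) * E_norm E (\<lambda>x. max 0 (u r x - \<theta>))"
      if r: "r \<in> {0<..T}" for r
    proof (rule upper_derivative_bound[OF _ R(1)])
      show "u r \<in> E_between E R" using range[of r] r by auto
      then show "E_norm E (\<lambda>x. G (u r) x - G w x) \<le> exp (k * R) * E_norm E (\<lambda>x. u r x - w x)"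
        if "w \<in> E_between E R" for w
        using k[OF R(2) _ that] by simp
      show "\<forall>\<^sub>F x in E_filter E. u' r x = \<kappa> * conv a (u r) x - m * u r x - u r x * G (u r) x"
        using eq[of r] r by (simp add: E_eq_iff)
    qed simp
  qed
  then show ?thesis by (simp add: E_le_iff)
qed

lemma solutions_comparison:
  assumes ex: "existence_hypotheses E G"
    and sol1: "nonneg_classical_solution E \<kappa> m a G v0 u1"
    and sol2: "nonneg_classical_solution E \<kappa> m a G w0 u2"
    and init: "E_le E v0 w0" "E_le E w0 (\<lambda>x. \<theta>)" and t: "0 \<le> t"
  shows "E_le E (u1 t) (u2 t)"
proof -
  obtain u1' where u1: "E_continuous_on E {0..} u1" "E_C1_on E {0<..} u1 u1'"
    and eq1: "\<And>t. 0 < t \<Longrightarrow>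
      E_eq E (u1' t) (\<lambda>x. \<kappa> * conv a (u1 t) x - m * u1 t x - u1 t x * G (u1 t) x)"
    and i1: "E_eq E (u1 0) v0" and nonneg1: "\<And>t. 0 \<le> t \<Longrightarrow> E_le E (\<lambda>x. 0) (u1 t)"
    using sol1 by (auto simp: nonneg_classical_solution_def classical_solution_def)
  obtain u2' where u2: "E_continuous_on E {0..} u2" "E_C1_on E {0<..} u2 u2'"
    and eq2: "\<And>t. 0 < t \<Longrightarrow>
      E_eq E (u2' t) (\<lambda>x. \<kappa> * conv a (u2 t) x - m * u2 t x - u2 t x * G (u2 t) x)"
    and i2: "E_eq E (u2 0) w0" and nonneg2: "\<And>t. 0 \<le> t \<Longrightarrow> E_le E (\<lambda>x. 0) (u2 t)"
    using sol2 by (auto simp: nonneg_classical_solution_def classical_solution_def)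
  have init1: "E_le E v0 (\<lambda>x. \<theta>)"
    using init unfolding E_le_iff by eventually_elim simp
  have range: "u1 s \<in> E_between E \<theta> \<and> u2 s \<in> E_between E \<theta>" if "0 \<le> s" for s
    using that u1(1) u2(1) nonneg1[OF that] nonneg2[OF that]
      solution_le_\<theta>[OF ex sol1 init1 that] solution_le_\<theta>[OF ex sol2 init(2) that]
    by (simp add: E_between_def E_continuous_on_def)
  show ?thesis
  proof (rule comparison[of "t + 1"])
    show "E_continuous_on E {0..t + 1} u1" "E_continuous_on E {0..t + 1} u2"
      using u1(1) u2(1) by (auto intro: E_continuous_on_subset)
    show "E_C1_on E {0<..t + 1} u1 u1'" "E_C1_on E {0<..t + 1} u2 u2'"
      using u1(2) u2(2) by (auto intro: E_C1_on_subset)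
    show "\<forall>\<^sub>F x in E_filter E.
          u1' s x - \<kappa> * conv a (u1 s) x + m * u1 s x + u1 s x * G (u1 s) x
        \<le> u2' s x - \<kappa> * conv a (u2 s) x + m * u2 s x + u2 s x * G (u2 s) x"
      if "s \<in> {0<..t + 1}" for s
    proof -
      have "0 < s" using that by simp
      from eq1[OF this] eq2[OF this] show ?thesis
        unfolding E_eq_iff by eventually_elim simp
    qed
    show "E_le E (u1 0) (u2 0)"
      using i1 i2 init(1) unfolding E_eq_iff E_le_iff by eventually_elim simp
  qed (use t range in auto)
qed

end

theorem theorem2p3:
  fixes E :: fspace
    and m \<kappa> \<beta> \<theta> :: real
    and a :: "real ^ 'n \<Rightarrow> real"
    and G :: "(real ^ 'n \<Rightarrow> real) \<Rightarrow> (real ^ 'n \<Rightarrow> real)"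
  assumes "m > 0" and "\<kappa> > 0"
    and "integrable lebesgue a" and "AE x in lebesgue. 0 \<le> a x"
    and "(LINT x|lebesgue. a x) = 1"
    and "E_map E G"
    and "\<beta> = \<kappa> - m" and "\<beta> > 0"
    and "\<theta> > 0"
    and "E_eq E (G (\<lambda>x. 0)) (\<lambda>x. 0)" and "E_eq E (G (\<lambda>x. \<theta>)) (\<lambda>x. \<beta>)"
    and "\<forall>v\<in>E_between E \<theta>. E_le E (G (\<lambda>x. 0)) (G v) \<and> E_le E (G v) (G (\<lambda>x. \<theta>))"
    and "\<exists>l>0. \<forall>v\<in>E_between E \<theta>. \<forall>w\<in>E_between E \<theta>.
           E_norm E (\<lambda>x. G v x - G w x) \<le> l * E_norm E (\<lambda>x. v x - w x)"
    and "\<exists>p\<ge>0. \<forall>v\<in>E_between E \<theta>. \<forall>w\<in>E_between E \<theta>. E_le E v w \<longrightarrow>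
           E_le E (\<lambda>x. \<kappa> * conv a v x - v x * G v x + p * v x)
                  (\<lambda>x. \<kappa> * conv a w x - w x * G w x + p * w x)"
  shows
    "(\<forall>(T::real) u1 u2 u1' u2'.
        T > 0 \<and>
        E_continuous_on E {0..T} u1 \<and> E_C1_on E {0<..T} u1 u1' \<and>
        E_continuous_on E {0..T} u2 \<and> E_C1_on E {0<..T} u2 u2' \<and>
        (\<forall>t\<in>{0<..T}.
           E_le E (\<lambda>x. u1' t x - \<kappa> * conv a (u1 t) x + m * u1 t x + u1 t x * G (u1 t) x)
                  (\<lambda>x. u2' t x - \<kappa> * conv a (u2 t) x + m * u2 t x + u2 t x * G (u2 t) x) \<and>
           E_le E (\<lambda>x. 0) (u1 t) \<and> E_le E (u1 t) (\<lambda>x. \<theta>) \<and>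
           E_le E (\<lambda>x. 0) (u2 t) \<and> E_le E (u2 t) (\<lambda>x. \<theta>)) \<and>
        E_le E (\<lambda>x. 0) (u1 0) \<and> E_le E (u1 0) (u2 0) \<and> E_le E (u2 0) (\<lambda>x. \<theta>)
        \<longrightarrow> (\<forall>t\<in>{0..T}.
               E_le E (\<lambda>x. 0) (u1 t) \<and> E_le E (u1 t) (u2 t) \<and> E_le E (u2 t) (\<lambda>x. \<theta>)))
     \<and>
     (existence_hypotheses E G \<longrightarrow>
        (\<forall>u0\<in>E_carrier E. \<forall>u.
           E_le E (\<lambda>x. 0) u0 \<and> E_le E u0 (\<lambda>x. \<theta>) \<and>
           nonneg_classical_solution E \<kappa> m a G u0 u
           \<longrightarrow> (\<forall>t\<ge>0. E_le E (\<lambda>x. 0) (u t) \<and> E_le E (u t) (\<lambda>x. \<theta>))))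
     \<and>
     (existence_hypotheses E G \<longrightarrow>
        (\<forall>u1 u2.
           nonneg_classical_solution E \<kappa> m a G (u1 0) u1 \<and>
           nonneg_classical_solution E \<kappa> m a G (u2 0) u2 \<and>
           E_le E (\<lambda>x. 0) (u1 0) \<and> E_le E (u1 0) (u2 0) \<and> E_le E (u2 0) (\<lambda>x. \<theta>)
           \<longrightarrow> (\<forall>t\<ge>0.
                  E_le E (\<lambda>x. 0) (u1 t) \<and> E_le E (u1 t) (u2 t) \<and> E_le E (u2 t) (\<lambda>x. \<theta>))))"
proof -
  obtain l where l: "0 < l" and lip: "\<forall>v\<in>E_between E \<theta>. \<forall>w\<in>E_between E \<theta>.
      E_norm E (\<lambda>x. G v x - G w x) \<le> l * E_norm E (\<lambda>x. v x - w x)"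
    using assms(13) by blast
  obtain p where p: "0 \<le> p" and mono: "\<forall>v\<in>E_between E \<theta>. \<forall>w\<in>E_between E \<theta>. E_le E v w \<longrightarrow>
      E_le E (\<lambda>x. \<kappa> * conv a v x - v x * G v x + p * v x)
             (\<lambda>x. \<kappa> * conv a w x - w x * G w x + p * w x)"
    using assms(14) by blast
  interpret monotone_reaction E m \<kappa> \<theta> l p a G
  proof
    show "\<forall>\<^sub>F x in E_filter E. 0 \<le> G v x" if "v \<in> E_between E \<theta>" for v
    proof -
      have "E_le E (G (\<lambda>x. 0)) (G v)" using assms(12) that by blast
      with assms(10) show ?thesis unfolding E_le_iff E_eq_iff by eventually_elim simp
    qed
  qed (use assms(1-9,11) l p lip mono in \<open>auto simp: E_map_def E_eq_iff E_le_iff\<close>)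
  show ?thesis
  proof (intro conjI impI allI ballI; (elim conjE)?)
    fix T :: real and u1 u2 u1' u2' :: "real \<Rightarrow> real ^ 'n \<Rightarrow> real" and t
    assume *: "0 < T" "E_continuous_on E {0..T} u1" "E_C1_on E {0<..T} u1 u1'"
        "E_continuous_on E {0..T} u2" "E_C1_on E {0<..T} u2 u2'"
      and **: "\<forall>t\<in>{0<..T}.
           E_le E (\<lambda>x. u1' t x - \<kappa> * conv a (u1 t) x + m * u1 t x + u1 t x * G (u1 t) x)
                  (\<lambda>x. u2' t x - \<kappa> * conv a (u2 t) x + m * u2 t x + u2 t x * G (u2 t) x) \<and>
           E_le E (\<lambda>x. 0) (u1 t) \<and> E_le E (u1 t) (\<lambda>x. \<theta>) \<and>
           E_le E (\<lambda>x. 0) (u2 t) \<and> E_le E (u2 t) (\<lambda>x. \<theta>)"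
      and init: "E_le E (\<lambda>x. 0) (u1 0)" "E_le E (u1 0) (u2 0)" "E_le E (u2 0) (\<lambda>x. \<theta>)"
      and t: "t \<in> {0..T}"
    show "E_le E (\<lambda>x. 0) (u1 t)" "E_le E (u2 t) (\<lambda>x. \<theta>)"
      using ** init t by (cases "t = 0"; simp)+
    show "E_le E (u1 t) (u2 t)"
    proof (rule comparison[OF * _ _ init(2) t])
      show "u1 s \<in> E_between E \<theta> \<and> u2 s \<in> E_between E \<theta>" if "s \<in> {0<..T}" for s
        using ** *(2,4) that by (auto simp: E_between_def E_continuous_on_def)
    qed (use ** in \<open>simp add: E_le_iff\<close>)
  next
    fix u0 u and t :: real
    assume "existence_hypotheses E G" "E_le E u0 (\<lambda>x. \<theta>)" "0 \<le> t"
      and sol: "nonneg_classical_solution E \<kappa> m a G u0 u"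
    then show "E_le E (u t) (\<lambda>x. \<theta>)" by (intro solution_le_\<theta>)
    show "E_le E (\<lambda>x. 0) (u t)"
      using sol \<open>0 \<le> t\<close> by (simp add: nonneg_classical_solution_def)
  next
    fix u1 u2 and t :: real
    assume "existence_hypotheses E G" "E_le E (u1 0) (u2 0)" "E_le E (u2 0) (\<lambda>x. \<theta>)" "0 \<le> t"
      and sol: "nonneg_classical_solution E \<kappa> m a G (u1 0) u1"
        "nonneg_classical_solution E \<kappa> m a G (u2 0) u2"
    then show "E_le E (u1 t) (u2 t)" "E_le E (u2 t) (\<lambda>x. \<theta>)"
      by (blast intro: solutions_comparison solution_le_\<theta>)+
    show "E_le E (\<lambda>x. 0) (u1 t)"
      using sol \<open>0 \<le> t\<close> by (simp add: nonneg_classical_solution_def)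
  qed
qed

end
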